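(* Let $n\ge 3$ and write $n=\prod_p p^{e_p}$ (so $p^{e_p}\parallel n$). Consider $n$th-power-free integers $a$ such that the pair $(n,a)$ satisfies Hypothesis (H), and let $\mathbf S_p(a)$ (for primes $p\mid n$) and $\mathbf S(a)$ denote the local $p$-shape and the global shape of $\mathcal O_{K_a}$, $K_a=\mathbb Q(\theta)$, $\theta^n=a$. Then: (i) (Local determinacy) For every prime $p\mid n$, if $a,a'$ are two such integers with $a\equiv a'\pmod{p^{e_p+1}}$, then $\mathbf S_p(a)=\mathbf S_p(a')$. (ii) (Local sharpness) For every prime $p\mid n$ there exist $n$th-power-free integers $a,a'$ (with $(n,a),(n,a')$ satisfying (H)) such that $a\equiv a'\pmod{p^{e_p}}$, $a\not\equiv a'\pmod{p^{e_p+1}}$, and $\mathbf S_p(a)\neq\mathbf S_p(a')$. (iii) (Global minimal period) Let $M(n):=\prod_{p^{e_p}\parallel n}p^{e_p+1}=n\cdot\mathrm{rad}(n)$. Then for all such $a,a'$, $a\equiv a'\pmod{M(n)}$ implies $\mathbf S(a)=\mathbf S(a')$; and if $N\ge 1$ is any integer such that $a\equiv a'\pmod N$ implies $\mathbf S(a)=\mathbf S(a')$ for all such $a,a'$, then $M(n)\mid N$.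
   Context: Fix $n\ge3$, write $n=\prod_p p^{e_p}$ and $\mathrm{rad}(n)=\prod_{p\mid n}p$. Let $a\in\mathbb Z$ be $n$th-power-free, $\theta$ a root of $x^n-a$, $K_a=\mathbb Q(\theta)$, and $v_p$ the $p$-adic valuation. Hypothesis (H): for every prime $p\mid n$, either $v_p(a)=0$ or $p\nmid v_p(a)$. Write $a=\pm\prod_{j=1}^{n-1}a_j$ with the $a_j$ positive, squarefree and pairwise coprime, and set $C_m(a)=\prod_{j=1}^{n-1}a_j^{\lfloor jm/n\rfloor}$ for $0\le m\le n-1$. For $p\mid n$ put $r_p(a)=v_p(a^{p-1}-1)-1$ if $v_p(a)=0$ and $r_p(a)=-1$ if $v_p(a)>0$, and $d_p(a)=\min\{r_p(a),e_p\}$. For $1\le m\le n-1$ let $k_{p,m}$ be the largest integer $k$ with $0\le k\le d_p(a)$ and $m\ge n-n/p^{k}$ ($k_{p,m}=0$ if none exists). By the explicit construction of Jakhar–Khanduja–Sangwan, under (H) there are elements $\beta_m\in\mathbb Z[\theta]$, $\mathbb Z$-linear combinations of $1,\theta,\dots,\theta^{m-1}$, such that $\{1\}\cup\{(\theta^m+\beta_m)/(C_m(a)\prod_{p\mid n}p^{k_{p,m}}):1\le m\le n-1\}$ is an integral basis of $\mathcal O_{K_a}$, the class of $\beta_m$ modulo $p^{k_{p,m}}$ being determined by $p,n,m,a$. The local $p$-shape is $\mathbf S_p(a)=\big((k_{p,m})_{m=1}^{n-1},(\beta_m\bmod p^{k_{p,m}})_{m=1}^{n-1}\big)$, where the residue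 class is regarded as trivial when $k_{p,m}=0$; the (global) shape is $\mathbf S(a)=(\mathbf S_p(a))_{p\mid n}$. *)

theory Defs
  imports
    "HOL-Computational_Algebra.Computational_Algebra"
    "HOL-Number_Theory.Totient"
    "HOL-Library.Extended_Real"
    "HOL-Library.FuncSet"
begin

section \<open>The integers under consideration\<close>

definition nth_power_free :: "nat \<Rightarrow> int \<Rightarrow> bool" where
  "nth_power_free n a \<longleftrightarrow> (\<forall>d. d ^ n dvd a \<longrightarrow> is_unit d)"

definition hypothesis_H :: "nat \<Rightarrow> int \<Rightarrow> bool" where
  "hypothesis_H n a \<longleftrightarrow>
     (\<forall>p. prime p \<and> p dvd n \<longrightarrow>
        multiplicity (int p) a = 0 \<or> \<not> p dvd multiplicity (int p) a)"

definition admissible :: "nat \<Rightarrow> int set" where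
  "admissible n = {a. nth_power_free n a \<and> hypothesis_H n a}"

text \<open>
  For \<open>n \<ge> 3\<close> and \<open>a \<in> admissible n\<close> the polynomial \<open>x ^ n - a\<close> can be reducible
  (e.g. \<open>n = 6\<close>, \<open>a = 8\<close>). The field generated by a root \<open>\<theta>\<close> has degree \<open>n\<close>, as is
  necessary for an integral basis with \<open>n\<close> elements, only for \<open>a\<close> in the following subset.
\<close>

definition irreducible_admissible :: "nat \<Rightarrow> int set" where
  "irreducible_admissible n =
     {a \<in> admissible n. irreducible (monom 1 n - [:of_int a:] :: rat poly)}"


section \<open>The denominators of the integral basis\<close>

text \<open>
  \<open>a_part a j\<close> is the factor \<open>a\<^sub>j\<close> in \<open>a = \<plusminus> (\<Prod>j=1..n-1. a\<^sub>j ^ j)\<close> with the \<open>a\<^sub>j\<close> positive,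
  squarefree and pairwise coprime.
\<close>

definition a_part :: "int \<Rightarrow> nat \<Rightarrow> int" where
  "a_part a j = \<Prod>{q \<in> prime_factors a. multiplicity q a = j}"

definition C_denom :: "nat \<Rightarrow> int \<Rightarrow> nat \<Rightarrow> int" where
  "C_denom n a m = (\<Prod>j = 1..n-1. a_part a j ^ (j * m div n))"

text \<open>The \<open>p\<close>-adic valuation with the value \<open>\<infinity>\<close> at \<open>0\<close>, where \<^const>\<open>multiplicity\<close> is \<open>0\<close>.\<close>

definition val_p :: "nat \<Rightarrow> int \<Rightarrow> ereal" where
  "val_p p x = (if x = 0 then \<infinity> else ereal (multiplicity (int p) x))"

definition r_exp :: "nat \<Rightarrow> int \<Rightarrow> ereal" where
  "r_exp p a = (if val_p p a = 0 then val_p p (a ^ (p - 1) - 1) - 1 else -1)"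

definition d_exp :: "nat \<Rightarrow> nat \<Rightarrow> int \<Rightarrow> ereal" where
  "d_exp n p a = min (r_exp p a) (ereal (multiplicity p n))"

text \<open>The quotient \<open>n div p ^ k\<close> below is exact, since \<open>k \<le> d_exp n p a\<close> is at most the exponent of \<open>p\<close> in \<open>n\<close>.\<close>

definition k_exp :: "nat \<Rightarrow> int \<Rightarrow> nat \<Rightarrow> nat \<Rightarrow> nat" where
  "k_exp n a p m =
     (let K = {k :: nat. ereal k \<le> d_exp n p a \<and> n - n div p ^ k \<le> m}
      in if K = {} then 0 else Max K)"


section \<open>The numerators of the integral basis\<close>

text \<open>
  An integral combination of \<open>1, \<theta>, \<dots>, \<theta> ^ (m - 1)\<close> is represented by the polynomial of
  degree \<open>< m\<close> with the same coefficients.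

  Let \<open>k = k_exp n a p m > 0\<close> and \<open>y = \<theta> ^ (n / p ^ k)\<close>, so \<open>y ^ (p ^ k) = a\<close>. As \<open>k \<le> r_exp p a\<close>,
  \<open>a ^ (p ^ k) \<equiv> a (mod p ^ (k + 1))\<close>, and therefore the quotient
  \<open>(y ^ (p ^ k) - a ^ (p ^ k)) / (y - a) = (\<Sum>j<p ^ k. a ^ (p ^ k - 1 - j) * y ^ j)\<close>
  is divisible by \<open>p ^ k\<close> in the ring of integers. Multiplying by the power of \<open>\<theta>\<close> that
  makes the leading term \<open>\<theta> ^ m\<close> gives the local numerator \<open>\<theta> ^ m + local_tail n a p m\<close>.
  For \<open>k = 0\<close> the tail is an empty sum.
\<close>

definition local_tail :: "nat \<Rightarrow> int \<Rightarrow> nat \<Rightarrow> nat \<Rightarrow> int poly" where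
  "local_tail n a p m =
     (let k = k_exp n a p m; s = n div p ^ k
      in \<Sum>j<p ^ k - 1. monom (a ^ (p ^ k - 1 - j)) (m - (n - s) + j * s))"

text \<open>
  The local numerators are glued by the Chinese remainder theorem. By Euler's theorem
  \<open>crt_coeff n a p m\<close> is congruent to \<open>1\<close> modulo \<open>p ^ k_exp n a p m\<close>, and it is divisible by
  \<open>C_denom n a m\<close> and by the powers \<open>q ^ k_exp n a q m\<close> for the other primes \<open>q\<close>. Hence
  \<open>(\<theta> ^ m + beta n a m) / (C_denom n a m * (\<Prod>p\<in>prime_factors n. p ^ k_exp n a p m))\<close> is integral.
\<close>

definition crt_coeff :: "nat \<Rightarrow> int \<Rightarrow> nat \<Rightarrow> nat \<Rightarrow> int" where
  "crt_coeff n a p m =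
     (C_denom n a m * (\<Prod>q \<in> prime_factors n - {p}. int q ^ k_exp n a q m))
       ^ totient (p ^ k_exp n a p m)"

definition beta :: "nat \<Rightarrow> int \<Rightarrow> nat \<Rightarrow> int poly" where
  "beta n a m = (\<Sum>p \<in> prime_factors n. smult (crt_coeff n a p m) (local_tail n a p m))"


section \<open>Shapes\<close>

text \<open>
  Classes modulo \<open>p ^ k\<close> are represented by the coefficient vectors with entries in
  \<open>{0..<p ^ k}\<close>; for \<open>k = 0\<close> this is always the zero polynomial.
\<close>

definition reduce_mod :: "int \<Rightarrow> int poly \<Rightarrow> int poly" where
  "reduce_mod N f = map_poly (\<lambda>c. c mod N) f"

definition local_shape :: "nat \<Rightarrow> nat \<Rightarrow> int \<Rightarrow> nat list \<times> int poly list" where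
  "local_shape n p a =
     (map (\<lambda>m. k_exp n a p m) [1..<n],
      map (\<lambda>m. reduce_mod (int p ^ k_exp n a p m) (beta n a m)) [1..<n])"

definition shape :: "nat \<Rightarrow> int \<Rightarrow> nat \<Rightarrow> nat list \<times> int poly list" where
  "shape n a = (\<lambda>p\<in>prime_factors n. local_shape n p a)"

definition rad :: "nat \<Rightarrow> nat" where
  "rad n = \<Prod>(prime_factors n)"

definition period_M :: "nat \<Rightarrow> nat" where
  "period_M n = (\<Prod>p\<in>prime_factors n. p ^ (multiplicity p n + 1))"

end

(*
  Modulo p^k with k = k_(p,m), the glued numerator beta_m is the local tail at p, and both k and
  the tail depend only on a mod p^(e+1): the condition k <= d_p(a) says k <= e, p does not divide a,
  and p^(k+1) divides a^(p-1) - 1. For sharpness take m = n - n/p^e. If a = 1 modulo p^(e+1) then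
  k = e, while if a' = 1 modulo p^e but not modulo p^(e+1) then k < e, since
  (a'^(p-1) - 1)/(a' - 1) = p - 1 modulo p. If p^(e+1) does not divide N, such a, a' exist with
  a = a' modulo N: the prescribed classes contain squarefree integers > 1 coprime to n, and these
  are admissible with x^n - a irreducible by Eisenstein.
*)
theory Submission
  imports Defs "HOL-Number_Theory.Residues"
begin

hide_const (open) Module.smult UnivPoly.coeff UnivPoly.monom

section \<open>Irreducibility over the rationals\<close>

text \<open>At the first index \<open>i\<close> with \<open>coeff F i\<close> not divisible by
  \<open>l\<close>, every other term of the convolution is divisible by \<open>l\<close>, so
  \<open>l\<close> would divide \<open>coeff F i * coeff G 0\<close>. The leading coefficient
  guarantees that such an \<open>i <= degree F\<close> exists.\<close>

lemma eisenstein_aux: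
  fixes F G :: "'a::idom poly"
  assumes l: "prime_elem l"
    and lead: "\<not> l dvd lead_coeff F"
    and G0: "\<not> l dvd coeff G 0"
    and low: "\<And>i. i \<le> degree F \<Longrightarrow> l dvd coeff (F * G) i"
  shows False
proof -
  define i where "i = (LEAST i. \<not> l dvd coeff F i)"
  have i: "\<not> l dvd coeff F i" and less: "\<And>j. j < i \<Longrightarrow> l dvd coeff F j"
    unfolding i_def using lead by (rule LeastI, metis not_less_Least)
  have "i \<le> degree F"
    unfolding i_def using lead by (rule Least_le)
  then have "l dvd coeff (F * G) i"
    by (rule low)
  moreover have "coeff (F * G) i = (\<Sum>j<i. coeff F j * coeff G (i - j)) + coeff F i * coeff G 0"
    by (simp add: coeff_mult lessThan_Suc_atMost[symmetric])
  moreover have "l dvd (\<Sum>j<i. coeff F j * coeff G (i - j))"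
    using less by (intro dvd_sum) auto
  ultimately have "l dvd coeff F i * coeff G 0"
    by (simp add: dvd_add_right_iff)
  with l i G0 show False
    by (simp add: prime_elem_dvd_mult_iff)
qed

text \<open>As \<open>l\<close> divides the constant term exactly once, one factor has a constant
  term prime to \<open>l\<close>. If both degrees are positive, the other factor has degree below
  that of the product, and \<open>eisenstein_aux\<close> applies to it.\<close>

lemma eisenstein:
  fixes F G :: "'a::idom poly"
  assumes l: "prime_elem l"
    and lead: "\<not> l dvd lead_coeff (F * G)"
    and low: "\<And>i. i < degree (F * G) \<Longrightarrow> l dvd coeff (F * G) i"
    and sq: "\<not> l\<^sup>2 dvd coeff (F * G) 0"
  shows "degree F = 0 \<or> degree G = 0"
proof (rule ccontr)
  assume deg: "\<not> ?thesis"
  have nz: "F \<noteq> 0" "G \<noteq> 0"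
    using lead by auto
  have degFG: "degree (F * G) = degree F + degree G"
    using nz by (rule degree_mult_eq)
  have leadF: "\<not> l dvd lead_coeff F" and leadG: "\<not> l dvd lead_coeff G"
    using lead by (auto simp: lead_coeff_mult)
  have "l dvd coeff F 0 * coeff G 0"
    using low[of 0] deg degFG by (simp add: coeff_mult)
  moreover have "\<not> (l dvd coeff F 0 \<and> l dvd coeff G 0)"
    using sq by (auto simp: coeff_mult power2_eq_square intro: mult_dvd_mono)
  ultimately consider "\<not> l dvd coeff G 0" | "\<not> l dvd coeff F 0"
    by blast
  then show False
  proof cases
    case 1
    show False
      by (rule eisenstein_aux[OF l leadF 1]) (use low deg degFG in auto)
  next
    case 2
    show False
      by (rule eisenstein_aux[OF l leadG 2])
        (use low deg degFG in \<open>auto simp: mult.commute[of G F]\<close>)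
  qed
qed

section \<open>Gauss's lemma: from rational to integer factorizations\<close>

lemma map_poly_of_int_mult:
  "map_poly of_int (p * q) = (map_poly of_int p * map_poly of_int q :: 'a::comm_ring_1 poly)"
  by (rule poly_eqI) (simp add: coeff_map_poly coeff_mult)

lemma map_poly_of_int_eq_iff:
  "map_poly of_int p = (map_poly of_int q :: 'a::{comm_ring_1,ring_char_0} poly) \<longleftrightarrow> p = q"
  by (simp add: poly_eq_iff coeff_map_poly)

lemma map_poly_of_int_smult:
  "map_poly of_int (smult c p) = (smult (of_int c) (map_poly of_int p) :: 'a::comm_ring_1 poly)"
  by (rule poly_eqI) (simp add: coeff_map_poly)

lemma rat_poly_clear_denominators:
  fixes p :: "rat poly"
  obtains c q where "c \<noteq> 0" "smult (of_int c) p = map_poly of_int q"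
proof -
  have "\<exists>c q. c \<noteq> 0 \<and> smult (of_int c) p = map_poly of_int q"
  proof (induction p)
    case 0
    show ?case
      by (intro exI[of _ 1] exI[of _ 0]) simp
  next
    case (pCons a p)
    then obtain c q where cq: "c \<noteq> 0" "smult (of_int c) p = map_poly of_int q"
      by blast
    obtain i j where ij: "quotient_of a = (i, j)"
      by force
    then have j: "j > 0" and a: "a = of_int i / of_int j"
      by (auto dest: quotient_of_denom_pos quotient_of_div)
    have "smult (of_int (c * j)) (pCons a p)
        = pCons (of_int (c * i)) (smult (of_int j) (smult (of_int c) p))"
      using j by (simp add: a mult.commute)
    also have "\<dots> = map_poly of_int (pCons (c * i) (smult j q))"
      by (rule poly_eqI) (simp add: cq(2) coeff_map_poly coeff_pCons split: nat.splits)
    finally show ?case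
      using cq(1) j by (intro exI[of _ "c * j"] exI) auto
  qed
  with that show thesis
    by blast
qed

text \<open>Clearing denominators turns a rational factorization into
  \<open>G * H = smult (c * d) f\<close>. Since \<open>f\<close> is primitive, passing to primitive
  parts removes the constant up to a sign.\<close>

lemma irreducible_map_poly_of_int:
  fixes f :: "int poly"
  assumes cont: "content f = 1" and deg: "degree f > 0"
    and irr: "\<And>F G. F * G = f \<Longrightarrow> degree F = 0 \<or> degree G = 0"
  shows "irreducible (map_poly of_int f :: rat poly)"
proof (rule irreducibleI)
  have degf: "degree (map_poly of_int f :: rat poly) = degree f"
    by (rule degree_map_poly) simp
  show nz: "(map_poly of_int f :: rat poly) \<noteq> 0"
    using deg degf by auto
  show "\<not> is_unit (map_poly of_int f :: rat poly)"
    using deg degf nz by (simp add: is_unit_iff_degree)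
  fix g h :: "rat poly"
  assume gh: "map_poly of_int f = g * h"
  obtain c G where G: "c \<noteq> 0" "smult (of_int c) g = map_poly of_int G"
    by (rule rat_poly_clear_denominators)
  obtain d H where H: "d \<noteq> 0" "smult (of_int d) h = map_poly of_int H"
    by (rule rat_poly_clear_denominators)
  have "(map_poly of_int (G * H) :: rat poly) = map_poly of_int (smult (c * d) f)"
    by (simp add: map_poly_of_int_mult map_poly_of_int_smult gh mult.commute flip: G(2) H(2))
  then have GH: "G * H = smult (c * d) f"
    by (simp add: map_poly_of_int_eq_iff)
  have pf: "primitive_part f = f"
    using cont content_times_primitive_part[of f] by simp
  have "primitive_part G * primitive_part H = smult (unit_factor (c * d)) f"
    using GH by (metis primitive_part_mult primitive_part_smult pf)
  \<comment> \<open>The unit factor is the sign of \<open>c * d\<close>, its own inverse, so it can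
    be absorbed into the first factor.\<close>
  moreover have "unit_factor (c * d) * unit_factor (c * d) = 1"
    using G(1) H(1) by (auto simp: sgn_if)
  ultimately have "smult (unit_factor (c * d)) (primitive_part G) * primitive_part H = f"
    by simp
  then have "degree (smult (unit_factor (c * d)) (primitive_part G)) = 0 \<or> degree (primitive_part H) = 0"
    by (rule irr)
  then have "degree G = 0 \<or> degree H = 0"
    using G(1) H(1) by (auto simp: sgn_if split: if_splits)
  moreover have "degree G = degree g" "degree H = degree h"
    using arg_cong[OF G(2), of degree] arg_cong[OF H(2), of degree] G(1) H(1)
    by (simp_all add: degree_map_poly)
  moreover have "g \<noteq> 0" "h \<noteq> 0"
    using gh nz by auto
  ultimately show "is_unit g \<or> is_unit h"
    by (simp add: is_unit_iff_degree)
qed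

lemma irreducible_monom_minus_const:
  fixes l a :: int
  assumes n: "n > 0" and l: "prime l" "l dvd a" "\<not> l\<^sup>2 dvd a"
  shows "irreducible (monom 1 n - [:of_int a:] :: rat poly)"
proof -
  define f where "f = monom 1 n - [:a:]"
  have coeff_f: "coeff f i = (if i = n then 1 else if i = 0 then - a else 0)" for i
    using n by (auto simp: f_def coeff_pCons split: nat.splits)
  have deg: "degree f = n"
    by (intro antisym degree_le le_degree) (auto simp: coeff_f)
  have "content f dvd 1"
    using content_dvd_coeff[of f n] coeff_f[of n] by simp
  then have "content f = 1"
    by (metis is_unit_normalize normalize_content)
  moreover have "degree F = 0 \<or> degree G = 0" if "F * G = f" for F G
  proof (rule eisenstein)
    show "prime_elem l"
      using l(1) by (rule prime_imp_prime_elem)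
  qed (use that l n not_prime_unit[of l] in \<open>auto simp: deg coeff_f\<close>)
  ultimately have "irreducible (map_poly of_int f :: rat poly)"
    using deg n by (intro irreducible_map_poly_of_int) auto
  moreover have "map_poly of_int f = (monom 1 n - [:of_int a:] :: rat poly)"
    by (rule poly_eqI) (auto simp: coeff_map_poly f_def coeff_pCons split: nat.splits)
  ultimately show ?thesis
    by simp
qed

section \<open>Squarefree numbers in coprime residue classes\<close>

text \<open>Each prime of \<open>M\<close> is exchanged for a prime of its class that exceeds the
  product built so far. The new prime is therefore coprime to that product, even if primes in
  \<open>M\<close> repeat.\<close>

lemma squarefree_prod_primes_in_class:
  fixes M :: "nat multiset" and L :: nat
  assumes "\<And>q. q \<in># M \<Longrightarrow> prime q \<and> infinite {l. prime l \<and> [l = q] (mod L)}"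
  shows "\<exists>s. squarefree s \<and> [s = prod_mset M] (mod L) \<and> (M \<noteq> {#} \<longrightarrow> s > 1)"
  using assms
proof (induction M)
  case empty
  show ?case
    by (intro exI[of _ 1]) auto
next
  case (add q M)
  then obtain s where s: "squarefree s" "[s = prod_mset M] (mod L)"
    by auto
  then have "s > 0"
    by (intro gr0I) auto
  have "\<not> {l. prime l \<and> [l = q] (mod L)} \<subseteq> {..s}"
    using add.prems[of q] finite_subset[of _ "{..s}"] by auto
  then obtain l where l: "prime l" "[l = q] (mod L)" "l > s"
    unfolding subset_iff by (metis atMost_iff mem_Collect_eq not_le)
  have "coprime l s"
    using l(1,3) \<open>s > 0\<close> by (simp add: prime_imp_coprime nat_dvd_not_less)
  then have "squarefree (l * s)"
    using l(1) s(1) by (simp add: squarefree_mult_coprime squarefree_prime)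
  moreover have "[l * s = prod_mset (add_mset q M)] (mod L)"
    using cong_mult[OF l(2) s(2)] by simp
  moreover have "l * s > 1"
    using less_le_trans[OF prime_gt_1_nat[OF l(1)], of "l * s"] \<open>s > 0\<close> by simp
  ultimately show ?case
    by blast
qed

text \<open>There are finitely many classes modulo \<open>L\<close>; infinitely many such primes
  would put infinitely many into one class, by the pigeonhole principle.\<close>

lemma finite_primes_in_finite_classes:
  fixes L :: nat
  assumes "L > 0"
  shows "finite {q. prime q \<and> finite {l. prime l \<and> [l = q] (mod L)}}" (is "finite ?B")
proof (rule ccontr)
  assume inf: "infinite ?B"
  have "(\<lambda>q. q mod L) ` ?B \<subseteq> {..<L}"
    using assms by auto
  then have "finite ((\<lambda>q. q mod L) ` ?B)"
    by (rule finite_subset) simp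
  from pigeonhole_infinite[OF inf this] obtain q
    where q: "q \<in> ?B" "infinite {l \<in> ?B. l mod L = q mod L}"
    by blast
  have "{l \<in> ?B. l mod L = q mod L} \<subseteq> {l. prime l \<and> [l = q] (mod L)}"
    by (auto simp: cong_def)
  with q show False
    using finite_subset by blast
qed

text \<open>
  Dirichlet's theorem is avoided: only finitely many primes lie in classes with finitely many
  primes. Choose a representative of the class of \<open>v\<close> coprime to all of these and replace its
  prime factors, with multiplicity, by distinct primes of the same classes.
\<close>

lemma squarefree_in_coprime_class:
  fixes v L :: nat
  assumes L: "L > 0" and v: "coprime v L"
  obtains s where "s > 1" "squarefree s" "[s = v] (mod L)"
proof -
  \<comment> \<open>Leaving out the prime divisors of \<open>L\<close> keeps the product
    \<open>R\<close> coprime to \<open>L\<close>. They cannot divide a number in the class of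
    \<open>v\<close> anyway.\<close>
  define B where "B = {q. prime q \<and> finite {l. prime l \<and> [l = q] (mod L)} \<and> \<not> q dvd L}"
  have "finite B"
    unfolding B_def by (rule finite_subset[OF _ finite_primes_in_finite_classes[OF L]]) auto
  define R where "R = \<Prod>B"
  have Bprime: "prime q" "\<not> q dvd L" if "q \<in> B" for q
    using that by (auto simp: B_def)
  have "coprime L q" if "q \<in> B" for q
    using prime_imp_coprime[OF Bprime[OF that]] by (simp add: coprime_commute)
  then have "coprime L R"
    unfolding R_def by (rule prod_coprime_right)
  then obtain y where y: "[y = v] (mod L)" "[y = 1] (mod R)"
    using binary_chinese_remainder_nat by blast
  have "R > 0"
    unfolding R_def using Bprime by (intro prod_pos) (auto simp: prime_gt_0_nat)
  \<comment> \<open>The shift changes neither class but forces \<open>x >= 2\<close>, so that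
    \<open>x\<close> has a prime factor and the resulting \<open>s\<close> exceeds 1.\<close>
  define x where "x = y + 2 * (L * R)"
  have x: "[x = v] (mod L)" "[x = 1] (mod R)"
    using y unfolding cong_def x_def
    by (metis mod_mult_self2 mult.left_commute, metis mod_mult_self2 mult.assoc mult.commute)
  have "L * R \<ge> 1"
    using L \<open>R > 0\<close> by (simp add: Suc_le_eq)
  then have "x > 1"
    unfolding x_def by linarith
  have good: "prime q \<and> infinite {l. prime l \<and> [l = q] (mod L)}" if "q \<in># prime_factorization x" for q
  proof
    show "prime q"
      using that by auto
    have qx: "q dvd x"
      using that by auto
    have "\<not> q dvd L"
    proof
      assume "q dvd L"
      with qx x(1) have "q dvd v"
        using cong_dvd_iff[OF cong_dvd_modulus_nat[OF x(1) \<open>q dvd L\<close>]] by simp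
      with v \<open>q dvd L\<close> \<open>prime q\<close> show False
        using coprime_common_divisor not_prime_unit by blast
    qed
    moreover have "q \<notin> B"
    proof
      assume "q \<in> B"
      then have qR: "q dvd R"
        unfolding R_def using \<open>finite B\<close> by (auto intro: dvd_prodI)
      with qx x(2) have "q dvd 1"
        using cong_dvd_iff[OF cong_dvd_modulus_nat[OF x(2) qR]] by simp
      with \<open>prime q\<close> show False
        by simp
    qed
    ultimately show "infinite {l. prime l \<and> [l = q] (mod L)}"
      using \<open>prime q\<close> by (simp add: B_def)
  qed
  obtain s where s: "squarefree s" "[s = prod_mset (prime_factorization x)] (mod L)"
      "prime_factorization x \<noteq> {#} \<longrightarrow> s > 1"
    using squarefree_prod_primes_in_class[OF good] by blast
  have "prod_mset (prime_factorization x) = x"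
    using \<open>x > 1\<close> by (simp add: prod_mset_prime_factorization_nat)
  moreover have "prime_factorization x \<noteq> {#}"
    using \<open>x > 1\<close> by (auto simp: prime_factorization_empty_iff)
  ultimately show thesis
    using s cong_trans[OF _ x(1)] by (intro that[of s]) auto
qed

section \<open>Local determinacy\<close>

lemma ereal_Suc_le_val_p_iff:
  assumes "prime p"
  shows "ereal (real (Suc k)) \<le> val_p p x \<longleftrightarrow> int p ^ Suc k dvd x"
\<comment> \<open>At 0 the value infinity matches divisibility by every power; this case arises for
  \<open>a ^ (p - 1) - 1\<close> with \<open>a = 1\<close>.\<close>
proof (cases "x = 0")
  case False
  have "\<not> is_unit (int p)"
    using assms by (simp add: prime_nat_iff)
  with False show ?thesis
    unfolding val_p_def by (subst power_dvd_iff_le_multiplicity) auto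
qed (simp add: val_p_def)

lemma val_p_eq_0_iff:
  assumes "prime p"
  shows "val_p p a = 0 \<longleftrightarrow> \<not> int p dvd a"
  using ereal_Suc_le_val_p_iff[OF assms, of 0 a]
  by (auto simp: val_p_def not_dvd_imp_multiplicity_0 zero_ereal_def one_ereal_def split: if_splits)

text \<open>The \<open>- 1\<close> in \<open>r_exp\<close> becomes the shift from \<open>k\<close>
  to \<open>Suc k\<close>, and its value \<open>-1\<close> for \<open>p\<close> dividing
  \<open>a\<close> excludes every natural \<open>k\<close>.\<close>

lemma le_d_exp_iff:
  assumes "prime p"
  shows "ereal (real k) \<le> d_exp n p a \<longleftrightarrow>
    k \<le> multiplicity p n \<and> \<not> int p dvd a \<and> int p ^ Suc k dvd a ^ (p - 1) - 1"
proof -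
  have "ereal (real k) \<le> val_p p y - 1 \<longleftrightarrow> ereal (real (Suc k)) \<le> val_p p y" for y
    by (cases "val_p p y") (auto simp: one_ereal_def)
  then have "ereal (real k) \<le> r_exp p a \<longleftrightarrow> \<not> int p dvd a \<and> int p ^ Suc k dvd a ^ (p - 1) - 1"
    using assms by (auto simp: r_exp_def val_p_eq_0_iff ereal_Suc_le_val_p_iff one_ereal_def
      simp del: power_Suc of_nat_Suc)
  then show ?thesis
    by (auto simp: d_exp_def)
qed

text \<open>The conditions see \<open>a\<close> only modulo \<open>p ^ Suc k\<close>, and
  \<open>k\<close> is at most the multiplicity \<open>e\<close> of \<open>p\<close> in
  \<open>n\<close>. This is where the exponent \<open>e + 1\<close> of the period comes
  from.\<close>

lemma le_d_exp_cong:
  assumes p: "prime p" and cong: "[a = a'] (mod int p ^ (multiplicity p n + 1))"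
  shows "ereal (real k) \<le> d_exp n p a \<longleftrightarrow> ereal (real k) \<le> d_exp n p a'"
proof (cases "k \<le> multiplicity p n")
  case True
  then have "int p ^ Suc k dvd int p ^ (multiplicity p n + 1)"
    by (intro le_imp_power_dvd) simp
  then have c: "[a = a'] (mod int p ^ Suc k)"
    using cong cong_dvd_modulus by blast
  then have "[a = a'] (mod int p)"
    by (rule cong_dvd_modulus) simp
  then have "int p dvd a \<longleftrightarrow> int p dvd a'"
    by (rule cong_dvd_iff)
  moreover have "[a ^ (p - 1) - 1 = a' ^ (p - 1) - 1] (mod int p ^ Suc k)"
    using c by (intro cong_diff cong_pow) auto
  then have "int p ^ Suc k dvd a ^ (p - 1) - 1 \<longleftrightarrow> int p ^ Suc k dvd a' ^ (p - 1) - 1"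
    by (rule cong_dvd_iff)
  ultimately show ?thesis
    by (simp only: le_d_exp_iff[OF p])
qed (simp add: le_d_exp_iff[OF p])

lemma k_exp_cong:
  assumes "prime p" "[a = a'] (mod int p ^ (multiplicity p n + 1))"
  shows "k_exp n a p m = k_exp n a' p m"
  unfolding k_exp_def by (simp only: le_d_exp_cong[OF assms])

text \<open>The candidates for \<open>k\<close> are bounded by \<open>multiplicity p n\<close>, so
  \<open>Max\<close> is attained; the first case accounts for the default value on an empty
  set.\<close>

lemma k_exp_cases:
  assumes p: "prime p"
  obtains "k_exp n a p m = 0"
  | "ereal (real (k_exp n a p m)) \<le> d_exp n p a" "n - n div p ^ k_exp n a p m \<le> m"
proof -
  define K where "K = {k :: nat. ereal k \<le> d_exp n p a \<and> n - n div p ^ k \<le> m}"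
  have "K \<subseteq> {..multiplicity p n}"
    by (auto simp: K_def le_d_exp_iff[OF p])
  then have "finite K"
    by (rule finite_subset) simp
  moreover have "k_exp n a p m = (if K = {} then 0 else Max K)"
    by (simp only: k_exp_def K_def Let_def)
  ultimately have "k_exp n a p m = 0 \<or> k_exp n a p m \<in> K"
    by auto
  then show thesis
    using that by (auto simp: K_def)
qed

lemma k_exp_le_multiplicity:
  "prime p \<Longrightarrow> k_exp n a p m \<le> multiplicity p n"
  by (rule k_exp_cases[of p n a m]) (auto simp: le_d_exp_iff)

lemma le_k_exp:
  assumes p: "prime p" and k: "ereal (real k) \<le> d_exp n p a" "n - n div p ^ k \<le> m"
  shows "k \<le> k_exp n a p m"
proof -
  define K where "K = {k :: nat. ereal k \<le> d_exp n p a \<and> n - n div p ^ k \<le> m}"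
  have "K \<subseteq> {..multiplicity p n}"
    by (auto simp: K_def le_d_exp_iff[OF p])
  then have "finite K"
    by (rule finite_subset) simp
  moreover have "k \<in> K"
    using k by (simp add: K_def)
  moreover have "k_exp n a p m = (if K = {} then 0 else Max K)"
    by (simp only: k_exp_def K_def Let_def)
  ultimately show ?thesis
    by auto
qed

section \<open>The glued numerators modulo powers of p\<close>

lemma coprime_C_denom:
  assumes "prime p" "\<not> int p dvd a"
  shows "coprime (int p) (C_denom n a m)"
  unfolding C_denom_def a_part_def
proof (intro prod_coprime_right coprime_power_right_iff[THEN iffD2] disjI1)
  fix j q
  assume "q \<in> {q \<in> prime_factors a. multiplicity q a = j}"
  then have "prime q" "q dvd a"
    by auto
  with assms show "coprime (int p) q"
    by (intro primes_coprime) auto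
qed

text \<open>For exponent 0 the modulus is 1. Otherwise \<open>p\<close> does not divide
  \<open>a\<close>, hence is coprime to \<open>C_denom\<close> and to the other primes of
  \<open>n\<close>, and Euler's theorem applies.\<close>

lemma crt_coeff_cong_1:
  assumes p: "prime p"
  shows "[crt_coeff n a p m = 1] (mod int p ^ k_exp n a p m)"
proof (rule k_exp_cases[OF p, of n a m])
  assume "ereal (real (k_exp n a p m)) \<le> d_exp n p a"
  then have "\<not> int p dvd a"
    by (simp add: le_d_exp_iff[OF p])
  define c where "c = C_denom n a m * (\<Prod>q \<in> prime_factors n - {p}. int q ^ k_exp n a q m)"
  define N where "N = p ^ k_exp n a p m"
  have "coprime (int p) (\<Prod>q \<in> prime_factors n - {p}. int q ^ k_exp n a q m)"
    using p by (intro prod_coprime_right) (auto intro!: primes_coprime simp: in_prime_factors_iff)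
  then have "coprime (int p) c"
    unfolding c_def using coprime_C_denom[OF p \<open>\<not> int p dvd a\<close>] by simp
  then have "coprime c (int N)"
    by (simp add: N_def coprime_commute)
  have Npos: "N > 0"
    using p by (simp add: N_def prime_gt_0_nat)
  \<comment> \<open>Euler's theorem is applied to the natural residue \<open>b\<close> of the
    integer \<open>c\<close> and then carried back.\<close>
  define b where "b = nat (c mod int N)"
  have b: "int b = c mod int N"
    using Npos by (simp add: b_def)
  then have "[int b = c] (mod int N)"
    by (simp add: cong_def)
  then have "coprime (int b) (int N)"
    using \<open>coprime c (int N)\<close> cong_imp_coprime cong_sym by blast
  then have "[b ^ totient N = 1] (mod N)"
    by (intro euler_theorem) simp
  then have "[int b ^ totient N = 1] (mod int N)"
    by (metis cong_int_iff of_nat_1 of_nat_power)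
  then have "[c ^ totient N = 1] (mod int N)"
    using \<open>[int b = c] (mod int N)\<close> cong_pow cong_sym cong_trans by blast
  then show ?thesis
    by (simp add: crt_coeff_def c_def N_def)
qed simp

lemma crt_coeff_cong_0:
  assumes p: "p \<in> prime_factors n" "p \<noteq> q" "prime q"
  shows "[crt_coeff n a q m = 0] (mod int p ^ k_exp n a p m)"
proof -
  have "int p ^ k_exp n a p m dvd (\<Prod>q \<in> prime_factors n - {q}. int q ^ k_exp n a q m)"
    using p by (intro dvd_prodI) auto
  \<comment> \<open>A zero exponent would turn the power into 1 and lose the divisibility.\<close>
  moreover have "totient (q ^ k_exp n a q m) > 0"
    using p by (simp add: prime_gt_0_nat)
  ultimately show ?thesis
    unfolding cong_0_iff crt_coeff_def
    by (metis dvd_mult dvd_power dvd_trans)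
qed

text \<open>Modulo the power of \<open>p\<close> the coefficients \<open>crt_coeff\<close> act as 1
  at \<open>p\<close> and 0 at the other primes. This frees the local shape from
  \<open>C_denom\<close> and from the exponents at other primes.\<close>

lemma coeff_beta_cong:
  assumes p: "p \<in> prime_factors n"
  shows "[coeff (beta n a m) i = coeff (local_tail n a p m) i] (mod int p ^ k_exp n a p m)"
proof -
  have "coeff (beta n a m) i
      = (\<Sum>q\<in>prime_factors n. crt_coeff n a q m * coeff (local_tail n a q m) i)"
    by (simp add: beta_def coeff_sum)
  also have "[\<dots> = (\<Sum>q\<in>prime_factors n. if q = p then coeff (local_tail n a p m) i else 0)]
      (mod int p ^ k_exp n a p m)"
  proof (rule cong_sum)
    fix q
    assume q: "q \<in> prime_factors n"
    show "[crt_coeff n a q m * coeff (local_tail n a q m) i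
        = (if q = p then coeff (local_tail n a p m) i else 0)] (mod int p ^ k_exp n a p m)"
    proof (cases "q = p")
      case True
      have "prime p"
        using p by auto
      from cong_mult[OF crt_coeff_cong_1[OF this] cong_refl] True show ?thesis
        by fastforce
    next
      case False
      have "prime q"
        using q by auto
      from cong_mult[OF crt_coeff_cong_0[OF p False[symmetric] this] cong_refl] False show ?thesis
        by fastforce
    qed
  qed
  finally show ?thesis
    using p by simp
qed

lemma coeff_local_tail_cong:
  assumes "[a = a'] (mod int p ^ k)" "k_exp n a p m = k_exp n a' p m"
  shows "[coeff (local_tail n a p m) i = coeff (local_tail n a' p m) i] (mod int p ^ k)"
  using assms
  by (auto simp: local_tail_def Let_def coeff_sum intro!: cong_sum cong_pow)

lemma reduce_mod_eq_iff:
  "reduce_mod N f = reduce_mod N g \<longleftrightarrow> (\<forall>i. [coeff f i = coeff g i] (mod N))"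
  by (auto simp: reduce_mod_def poly_eq_iff coeff_map_poly cong_def)

text \<open>The modulus \<open>p ^ (e + 1)\<close> first makes the exponents agree; they are at most
  \<open>e\<close>, so the tails then agree modulo the common power of \<open>p\<close>.\<close>

lemma local_shape_cong:
  assumes p: "p \<in> prime_factors n" and cong: "[a = a'] (mod int p ^ (multiplicity p n + 1))"
  shows "local_shape n p a = local_shape n p a'"
proof -
  have "prime p"
    using p by auto
  note k = k_exp_cong[OF this cong]
  have "reduce_mod (int p ^ k_exp n a p m) (beta n a m) = reduce_mod (int p ^ k_exp n a' p m) (beta n a' m)"
    for m
  proof -
    have "int p ^ k_exp n a p m dvd int p ^ (multiplicity p n + 1)"
      using k_exp_le_multiplicity[OF \<open>prime p\<close>, of n a m] by (intro le_imp_power_dvd) simp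
    with cong have "[a = a'] (mod int p ^ k_exp n a p m)"
      by (rule cong_dvd_modulus)
    then have "[coeff (local_tail n a p m) i = coeff (local_tail n a' p m) i] (mod int p ^ k_exp n a p m)" for i
      using k by (rule coeff_local_tail_cong)
    then have "[coeff (beta n a m) i = coeff (beta n a' m) i] (mod int p ^ k_exp n a p m)" for i
      using coeff_beta_cong[OF p, of a m i] coeff_beta_cong[OF p, of a' m i]
      unfolding k[symmetric] by (meson cong_sym cong_trans)
    then show ?thesis
      by (simp add: reduce_mod_eq_iff flip: k)
  qed
  with k show ?thesis
    by (simp add: local_shape_def)
qed

section \<open>Sharpness\<close>

text \<open>In \<open>a ^ (p - 1) - 1 = (a - 1) * (\<Sum>i<p - 1. a ^ i)\<close> the sum is
  \<open>p - 1\<close> modulo \<open>p\<close>, hence prime to \<open>p\<close>, so any power of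
  \<open>p\<close> dividing the product divides \<open>a - 1\<close>.\<close>

lemma not_dvd_power_minus_1:
  fixes a :: int
  assumes p: "prime p" and e: "e > 0" and a: "[a = 1] (mod int p ^ e)"
    and na: "\<not> [a = 1] (mod int p ^ Suc e)"
  shows "\<not> int p ^ Suc e dvd a ^ (p - 1) - 1"
proof
  assume dvd: "int p ^ Suc e dvd a ^ (p - 1) - 1"
  have "[a = 1] (mod int p)"
    using a e cong_dvd_modulus dvd_power by blast
  then have "[(\<Sum>i<p - 1. a ^ i) = (\<Sum>i<p - 1. 1 ^ i)] (mod int p)"
    by (intro cong_sum cong_pow)
  then have "[(\<Sum>i<p - 1. a ^ i) = int (p - 1)] (mod int p)"
    by simp
  moreover have "\<not> int p dvd int (p - 1)"
    using prime_gt_1_nat[OF p] by (subst int_dvd_int_iff) (simp add: nat_dvd_not_less)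
  ultimately have "\<not> int p dvd (\<Sum>i<p - 1. a ^ i)"
    using cong_dvd_iff by blast
  then have "coprime (int p ^ Suc e) (\<Sum>i<p - 1. a ^ i)"
    using p by (simp add: prime_imp_coprime del: power_Suc)
  with dvd have "int p ^ Suc e dvd a - 1"
    unfolding power_diff_1_eq by (simp add: coprime_dvd_mult_left_iff del: power_Suc)
  with na show False
    by (simp add: cong_iff_dvd_diff)
qed

lemma local_shape_neq:
  assumes p: "p \<in> prime_factors n"
    and a: "[a = 1] (mod int p ^ (multiplicity p n + 1))"
    and a': "[a' = 1] (mod int p ^ multiplicity p n)"
    and na': "\<not> [a' = 1] (mod int p ^ (multiplicity p n + 1))"
  shows "local_shape n p a \<noteq> local_shape n p a'"
proof
  assume eq: "local_shape n p a = local_shape n p a'"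
  define e where "e = multiplicity p n"
  \<comment> \<open>The least index at which \<open>k_exp\<close> can reach the value
    \<open>e\<close>.\<close>
  define m where "m = n - n div p ^ e"
  have p': "prime p" "p dvd n" "n > 0"
    using p by (auto simp: in_prime_factors_iff)
  have e: "e > 0"
    using p' by (simp add: e_def prime_multiplicity_gt_zero_iff)
  have "p ^ e dvd n"
    by (simp add: e_def multiplicity_dvd)
  moreover have "p ^ e > 1"
    using e prime_gt_1_nat[OF p'(1)] by (intro one_less_power)
  ultimately have m: "m \<in> set [1..<n]"
    using p'(3) by (auto simp: m_def dvd_def Suc_le_eq)
  then have k_eq: "k_exp n a p m = k_exp n a' p m"
    using eq by (auto simp: local_shape_def)
  have "[a = 1] (mod int p)"
    using a by (rule cong_dvd_modulus) simp
  then have "\<not> int p dvd a"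
    using cong_dvd_iff p'(1) by (metis int_dvd_int_iff not_prime_unit of_nat_1)
  moreover have "[a ^ (p - 1) = 1 ^ (p - 1)] (mod int p ^ Suc e)"
    using a by (intro cong_pow) (simp add: e_def)
  ultimately have "ereal (real e) \<le> d_exp n p a"
    by (simp add: le_d_exp_iff[OF p'(1)] cong_iff_dvd_diff e_def)
  then have "e \<le> k_exp n a p m"
    by (intro le_k_exp[OF p'(1)]) (simp_all add: m_def)
  then have k': "k_exp n a' p m = e"
    using k_exp_le_multiplicity[OF p'(1), of n a' m] k_eq unfolding e_def by linarith
  \<comment> \<open>Since \<open>e > 0\<close>, the exponent \<open>e\<close> is not the default
    value and must be a genuine candidate for \<open>a'\<close>.\<close>
  have "ereal (real e) \<le> d_exp n p a'"
    by (rule k_exp_cases[OF p'(1), of n a' m]) (use e k' in auto)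
  then have "int p ^ Suc e dvd a' ^ (p - 1) - 1"
    by (simp only: le_d_exp_iff[OF p'(1)])
  with not_dvd_power_minus_1[OF p'(1) e] a' na' show False
    by (simp add: e_def)
qed

text \<open>A nontrivial \<open>n\<close>th power contains a nontrivial square, coprimality makes
  the valuations in \<open>hypothesis_H\<close> vanish, and \<open>s > 1\<close> supplies a prime
  for Eisenstein. One witness thus serves both choices of \<open>A\<close>.\<close>

lemma squarefree_imp_admissible:
  assumes n: "n \<ge> 3" and s: "s > 1" "squarefree s" "coprime s n"
  shows "int s \<in> admissible n" "int s \<in> irreducible_admissible n"
proof -
  have sq: "\<not> (int d)\<^sup>2 dvd int s" if "d \<noteq> 1" for d
    using squarefreeD[OF s(2), of d] that by (metis int_dvd_int_iff nat_dvd_1_iff_1 of_nat_power)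
  have "nth_power_free n (int s)"
    unfolding nth_power_free_def
  proof (intro allI impI)
    fix d :: int
    assume "d ^ n dvd int s"
    moreover have "(int (nat \<bar>d\<bar>))\<^sup>2 dvd d ^ n"
      using n by (simp add: le_imp_power_dvd)
    ultimately have "nat \<bar>d\<bar> = 1"
      using sq dvd_trans by blast
    then show "is_unit d"
      by simp
  qed
  moreover have "hypothesis_H n (int s)"
    unfolding hypothesis_H_def
  proof (intro allI impI disjI1)
    fix p
    assume p: "prime p \<and> p dvd n"
    then have "\<not> p dvd s"
      using s(3) coprime_common_divisor[of s n p] not_prime_unit[of p] by blast
    then show "multiplicity (int p) (int s) = 0"
      by (simp add: not_dvd_imp_multiplicity_0)
  qed
  ultimately show adm: "int s \<in> admissible n"
    by (simp add: admissible_def)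
  obtain l where l: "prime l" "l dvd s"
    using s(1) prime_factor_nat[of s] by auto
  have "irreducible (monom 1 n - [:of_int (int s):] :: rat poly)"
  proof (rule irreducible_monom_minus_const)
    show "prime (int l)" "int l dvd int s"
      using l by auto
    have "l \<noteq> 1"
      using l(1) by auto
    then show "\<not> (int l)\<^sup>2 dvd int s"
      by (rule sq)
  qed (use n in auto)
  with adm show "int s \<in> irreducible_admissible n"
    by (simp add: irreducible_admissible_def)
qed

text \<open>Stated for general \<open>N\<close> to serve twice: \<open>N = p ^ e\<close> gives local
  sharpness, and arbitrary \<open>N\<close> gives minimality of the period.\<close>

lemma exists_local_shape_neq:
  fixes N :: nat
  assumes n: "n \<ge> 3" and A: "A = admissible n \<or> A = irreducible_admissible n"
    and p: "p \<in> prime_factors n"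
    and N: "N > 0" "\<not> p ^ (multiplicity p n + 1) dvd N"
  obtains a a' where "a \<in> A" "a' \<in> A" "[a = a'] (mod int N)"
    "[a = a'] (mod int p ^ multiplicity p n)"
    "\<not> [a = a'] (mod int p ^ (multiplicity p n + 1))"
    "local_shape n p a \<noteq> local_shape n p a'"
proof -
  define e where "e = multiplicity p n"
  have p': "prime p" "p dvd n" "n > 0"
    using p by (auto simp: in_prime_factors_iff)
  have "\<not> is_unit p"
    using p'(1) not_prime_unit by blast
  have e: "e > 0"
    using p' by (simp add: e_def prime_multiplicity_gt_zero_iff)
  obtain n' where n': "n = p ^ e * n'" "\<not> p dvd n'"
    unfolding e_def using p'(3) \<open>\<not> is_unit p\<close> by (metis multiplicity_decompose' not_gr0)
  define f where "f = multiplicity p N"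
  obtain N' where N': "N = p ^ f * N'" "\<not> p dvd N'"
    unfolding f_def using N(1) \<open>\<not> is_unit p\<close> by (metis multiplicity_decompose' not_gr0)
  have "f \<le> e"
  proof (rule ccontr)
    assume "\<not> f \<le> e"
    then have "p ^ (e + 1) dvd p ^ f"
      by (intro le_imp_power_dvd) simp
    with N(2) N'(1) show False
      by (simp add: e_def)
  qed
  \<comment> \<open>\<open>Q\<close> collects the parts of \<open>n\<close> and \<open>N\<close>
    prime to \<open>p\<close>. The witnesses are \<open>s\<close>, congruent to 1, and
    \<open>s'\<close>, congruent to \<open>1 + p ^ e * Q\<close>, modulo \<open>L\<close>; their
    difference is divisible by \<open>N\<close> (as \<open>f \<le> e\<close>) and by
    \<open>p ^ e\<close>, but not by \<open>p ^ (e + 1)\<close>.\<close>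
  define Q where "Q = n' * N'"
  define L where "L = p ^ (e + 1) * Q"
  have pQ: "\<not> p dvd Q"
    using n'(2) N'(2) p'(1) by (simp add: Q_def prime_dvd_mult_iff)
  have "Q > 0"
    using pQ by (intro gr0I) auto
  then have "L > 0"
    using p'(1) by (simp add: L_def prime_gt_0_nat)
  have dvd_pQ: "N dvd p ^ e * Q" "p ^ e * Q dvd L" "n dvd L" "p ^ (e + 1) dvd L"
    unfolding N'(1) n'(1)
    using le_imp_power_dvd[OF \<open>f \<le> e\<close>, of p] le_imp_power_dvd[of e "e + 1" p]
    by (auto simp only: Q_def L_def le_add1 intro!: mult_dvd_mono dvd_triv_left dvd_triv_right dvd_refl)
  obtain s where s: "s > 1" "squarefree s" "[s = 1] (mod L)"
    using squarefree_in_coprime_class[OF \<open>L > 0\<close>, of 1] by auto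
  \<comment> \<open>Coprimality to \<open>L\<close> reduces to the divisors \<open>p\<close> and
    \<open>Q\<close> of \<open>p ^ e * Q\<close>, where \<open>e > 0\<close> makes \<open>p\<close>
    a divisor.\<close>
  have "coprime (1 + p ^ e * Q) d" if "d dvd p ^ e * Q" for d
    using that by (intro coprimeI) (metis dvd_add_left_iff dvd_trans)
  from this[of p] this[of Q] have cop: "coprime (1 + p ^ e * Q) L"
    using e by (simp add: L_def)
  obtain s' where s': "s' > 1" "squarefree s'" "[s' = 1 + p ^ e * Q] (mod L)"
    using squarefree_in_coprime_class[OF \<open>L > 0\<close> cop] by auto
  have "coprime s L" "coprime s' L"
    using cop cong_imp_coprime[OF cong_sym[OF s(3)]] cong_imp_coprime[OF cong_sym[OF s'(3)]]
    by auto
  then have cop_n: "coprime s n" "coprime s' n"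
    using coprime_divisors[OF dvd_refl \<open>n dvd L\<close>] by auto
  have "[1 + p ^ e * Q = 1] (mod p ^ e * Q)"
    unfolding cong_def by (rule mod_add_self2)
  moreover have "[s = 1] (mod p ^ e * Q)" "[s' = 1 + p ^ e * Q] (mod p ^ e * Q)"
    using cong_dvd_modulus_nat[OF _ dvd_pQ(2)] s(3) s'(3) by auto
  ultimately have 1: "[s = s'] (mod p ^ e * Q)" "[s' = 1] (mod p ^ e * Q)"
    by (metis cong_sym cong_trans)+
  have 2: "[s = 1] (mod p ^ (e + 1))" "[s' = 1 + p ^ e * Q] (mod p ^ (e + 1))"
    using cong_dvd_modulus_nat[OF _ dvd_pQ(4)] s(3) s'(3) by auto
  have 3: "\<not> [s' = 1] (mod p ^ (e + 1))"
  proof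
    assume "[s' = 1] (mod p ^ (e + 1))"
    with 2(2) have "[1 + p ^ e * Q = 1 + 0] (mod p ^ (e + 1))"
      by (metis add.right_neutral cong_sym cong_trans)
    then have "[p ^ e * Q = 0] (mod p ^ (e + 1))"
      by (simp only: cong_add_lcancel_nat)
    then have "p ^ e * p dvd p ^ e * Q"
      by (simp add: cong_0_iff mult.commute)
    with pQ p'(1) show False
      by (simp add: prime_gt_0_nat)
  qed
  have to_int: "[int x = int y] (mod int p ^ k) \<longleftrightarrow> [x = y] (mod p ^ k)" for x y k
    using cong_int_iff[of x y "p ^ k"] by simp
  note to_int_1 = to_int[of _ 1, unfolded of_nat_1]
  show thesis
  proof (rule that)
    show "int s \<in> A" "int s' \<in> A"
      using A squarefree_imp_admissible[OF n s(1,2) cop_n(1)]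
        squarefree_imp_admissible[OF n s'(1,2) cop_n(2)] by auto
    show "[int s = int s'] (mod int N)"
      using cong_dvd_modulus_nat[OF 1(1) dvd_pQ(1)] by (simp add: cong_int_iff)
    show "[int s = int s'] (mod int p ^ multiplicity p n)"
      unfolding to_int using cong_dvd_modulus_nat[OF 1(1), of "p ^ e"] by (simp add: e_def)
    show "\<not> [int s = int s'] (mod int p ^ (multiplicity p n + 1))"
      unfolding to_int using 2(1) 3 unfolding e_def by (metis cong_sym cong_trans)
    show "local_shape n p (int s) \<noteq> local_shape n p (int s')"
    proof (rule local_shape_neq[OF p])
      show "[int s' = 1] (mod int p ^ multiplicity p n)"
        unfolding to_int_1 using cong_dvd_modulus_nat[OF 1(2), of "p ^ e"] by (simp add: e_def)
    qed (unfold to_int_1, use 2(1) 3 in \<open>simp_all only: e_def not_False_eq_True\<close>)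
  qed
qed

section \<open>The global period\<close>

lemma period_M_eq:
  assumes "n > 0"
  shows "period_M n = n * rad n"
proof -
  have "period_M n = (\<Prod>p\<in>prime_factors n. p ^ multiplicity p n) * (\<Prod>p\<in>prime_factors n. p)"
    by (simp add: period_M_def prod.distrib mult.commute)
  also have "(\<Prod>p\<in>prime_factors n. p ^ multiplicity p n) = n"
    using assms by (simp add: prod_prime_factors)
  finally show ?thesis
    by (simp add: rad_def)
qed

lemma shape_cong:
  assumes "[a = a'] (mod int (period_M n))"
  shows "shape n a = shape n a'"
  unfolding shape_def
proof (rule restrict_ext)
  fix p
  assume p: "p \<in> prime_factors n"
  have "p ^ (multiplicity p n + 1) dvd period_M n"
    unfolding period_M_def using p by (intro dvd_prodI) auto
  then have "int p ^ (multiplicity p n + 1) dvd int (period_M n)"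
    by (metis int_dvd_int_iff of_nat_power)
  with assms have "[a = a'] (mod int p ^ (multiplicity p n + 1))"
    by (rule cong_dvd_modulus)
  with p show "local_shape n p a = local_shape n p a'"
    by (rule local_shape_cong)
qed

text \<open>Powers of distinct primes are coprime; divisibility is read as congruence to 0 so that
  congruences for coprime moduli can be combined.\<close>

lemma period_M_dvdI:
  assumes "\<And>p. p \<in> prime_factors n \<Longrightarrow> p ^ (multiplicity p n + 1) dvd N"
  shows "period_M n dvd N"
  unfolding period_M_def cong_0_iff[symmetric]
proof (intro cong_cong_prod_coprime_nat ballI impI)
  fix p q
  assume "p \<in> prime_factors n" "q \<in> prime_factors n" "p \<noteq> q"
  then have "coprime p q"
    by (intro primes_coprime) auto
  then show "coprime (p ^ (multiplicity p n + 1)) (q ^ (multiplicity q n + 1))"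
    by simp
qed (use assms in \<open>simp add: cong_0_iff\<close>)

text \<open>The choice of \<open>A\<close> covers both readings: all admissible integers, or those
  with \<open>x ^ n - a\<close> irreducible. Determinacy passes to subsets of \<open>A\<close>,
  while sharpness and minimality pass to supersets.\<close>

theorem theorem3p1:
  fixes n :: nat and A :: "int set"
  assumes "n \<ge> 3"
    and "A = admissible n \<or> A = irreducible_admissible n"
  shows
    "(\<forall>p. prime p \<and> p dvd n \<longrightarrow>
        (\<forall>a\<in>A. \<forall>a'\<in>A. [a = a'] (mod int p ^ (multiplicity p n + 1)) \<longrightarrow>
           local_shape n p a = local_shape n p a'))
   \<and> (\<forall>p. prime p \<and> p dvd n \<longrightarrow>
        (\<exists>a\<in>A. \<exists>a'\<in>A. [a = a'] (mod int p ^ multiplicity p n) \<and>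
           \<not> [a = a'] (mod int p ^ (multiplicity p n + 1)) \<and>
           local_shape n p a \<noteq> local_shape n p a'))
   \<and> (period_M n = n * rad n \<and>
      (\<forall>a\<in>A. \<forall>a'\<in>A. [a = a'] (mod int (period_M n)) \<longrightarrow> shape n a = shape n a') \<and>
      (\<forall>N::nat. N \<ge> 1 \<and>
         (\<forall>a\<in>A. \<forall>a'\<in>A. [a = a'] (mod int N) \<longrightarrow> shape n a = shape n a') \<longrightarrow>
         period_M n dvd N))"
proof (intro conjI allI impI ballI)
  have n: "n > 0"
    using assms(1) by simp
  then show "period_M n = n * rad n"
    by (rule period_M_eq)
  {
    fix p a a'
    assume "prime p \<and> p dvd n" "[a = a'] (mod int p ^ (multiplicity p n + 1))"
    with n show "local_shape n p a = local_shape n p a'"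
      by (intro local_shape_cong) (auto simp: in_prime_factors_iff)
  }
  {
    fix p
    assume "prime p \<and> p dvd n"
    then have p: "p \<in> prime_factors n" "prime p"
      using n by (auto simp: in_prime_factors_iff)
    have "p ^ multiplicity p n > 0" "\<not> p ^ (multiplicity p n + 1) dvd p ^ multiplicity p n"
      using p(2) by (auto simp: prime_gt_0_nat power_dvd_imp_le dest!: power_dvd_imp_le[OF _ prime_gt_1_nat])
    then show "\<exists>a\<in>A. \<exists>a'\<in>A. [a = a'] (mod int p ^ multiplicity p n) \<and>
        \<not> [a = a'] (mod int p ^ (multiplicity p n + 1)) \<and> local_shape n p a \<noteq> local_shape n p a'"
      using exists_local_shape_neq[OF assms p(1)] by metis
  }
  {
    fix a a'
    assume "[a = a'] (mod int (period_M n))"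
    then show "shape n a = shape n a'"
      by (rule shape_cong)
  }
  {
    fix N :: nat
    assume N: "N \<ge> 1 \<and> (\<forall>a\<in>A. \<forall>a'\<in>A. [a = a'] (mod int N) \<longrightarrow> shape n a = shape n a')"
    show "period_M n dvd N"
    proof (rule period_M_dvdI, rule ccontr)
      fix p
      assume p: "p \<in> prime_factors n" and ndvd: "\<not> p ^ (multiplicity p n + 1) dvd N"
      have "N > 0"
        using conjunct1[OF N] by simp
      then obtain a a' where a: "a \<in> A" "a' \<in> A" "[a = a'] (mod int N)"
          "local_shape n p a \<noteq> local_shape n p a'"
        by (rule exists_local_shape_neq[OF assms p _ ndvd]) (rule that)
      with N have "shape n a = shape n a'"
        by blast
      \<comment> \<open>As \<open>p\<close> lies in \<open>prime_factors n\<close>, the restricted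
        function \<open>shape\<close> takes the value \<open>local_shape\<close> at
        \<open>p\<close>.\<close>
      from fun_cong[OF this, of p] a(4) p show False
        by (simp add: shape_def)
    qed
  }
qed

end
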